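(* Let $G=S_\infty$ and let $M,N\subseteq S(G)$ be minimal subflows. The following are equivalent: (1) $A^M=A^N$; (2) for all idempotents $u\in M$ and $v\in N$, the product $uv\in M$ is an idempotent.
   Context: View $S_\infty$ as the automorphism group of $\omega$ in the empty language, $\mathbf{A}_n=\{0,\dots,n-1\}$, $H_n$ the set of injections $n\to\omega$. $S(G)$ is the inverse limit of the spaces $\beta H_n$ along the continuous extensions of restriction maps, $\alpha(n)$ the $n$-th coordinate; right action: $S\in(\alpha g)(m)$ iff $\{x\in H_n:x\circ g|_m\in S\}\in\alpha(n)$ (for $n$ large); writing $\alpha\cdot f=(\alpha g)(m)$ for any $g$ extending $f\in H_m$, the semigroup product is $S\in(\alpha\gamma)(m)$ iff $\{f\in H_m:S\in\alpha\cdot f\}\in\gamma(m)$. Minimal subflows are the minimal right ideals; $u$ is idempotent if $uu=u$. For a closed $Y\subseteq S(G)$, $\mathcal{F}^Y_2=\{T\subseteq H_2:T\in\alpha(2)\ \forall\alpha\in Y\}$; $\phi:H_2\to[\omega]^2$ forgets the order, and $\phi(\mathcal{F})=\{T:\phi^{-1}(T)\in\mathcal{F}\}$. $\mathrm{LO}(\omega)$ is the set of linear orders on $\omega$. For $<_0,<_1\in\mathrm{LO}(\omega)$, $A(<_0,<_1)=\{\{a,b\}\in[\omega]^2:(a<_0b\iff a<_1b)\}$, and $A^M=\{(<_0,<_1)\in\mathrm{LO}(\omega)^2:A(<_0,<_1)\in\phi(\mathcal{F}^M_2)\}$. *)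

theory Defs
  imports Main
begin

text \<open>Injections n -> omega, represented as lists of length n with distinct entries
  (the list xs represents i |-> xs!i).\<close>
definition H :: "nat \<Rightarrow> nat list set" where
  "H n = {xs. length xs = n \<and> distinct xs}"

definition ultrafilter_on :: "'a set \<Rightarrow> 'a set set \<Rightarrow> bool" where
  "ultrafilter_on X U \<longleftrightarrow> U \<subseteq> Pow X \<and> X \<in> U \<and> {} \<notin> U
     \<and> (\<forall>A\<in>U. \<forall>B\<in>U. A \<inter> B \<in> U)
     \<and> (\<forall>A\<in>U. \<forall>B. A \<subseteq> B \<and> B \<subseteq> X \<longrightarrow> B \<in> U)
     \<and> (\<forall>A. A \<subseteq> X \<longrightarrow> A \<in> U \<or> X - A \<in> U)"

text \<open>S(G): inverse limit of beta H_n along the extensions of the restriction maps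
  (restriction of x in H_n to m is take m x).\<close>
definition SG :: "(nat \<Rightarrow> nat list set set) set" where
  "SG = {\<alpha>. (\<forall>n. ultrafilter_on (H n) (\<alpha> n))
          \<and> (\<forall>m n. m \<le> n \<longrightarrow>
               (\<forall>S. S \<in> \<alpha> m \<longleftrightarrow> S \<subseteq> H m \<and> {x \<in> H n. take m x \<in> S} \<in> \<alpha> n))}"

definition bnd :: "nat list \<Rightarrow> nat" where
  "bnd f = Suc (Max (insert 0 (set f)))"

definition act :: "(nat \<Rightarrow> nat list set set) \<Rightarrow> nat list \<Rightarrow> nat list set set" where
  "act \<alpha> f = {S. S \<subseteq> H (length f) \<and> {x \<in> H (bnd f). map (\<lambda>i. x ! i) f \<in> S} \<in> \<alpha> (bnd f)}"

definition mult :: "(nat \<Rightarrow> nat list set set) \<Rightarrow> (nat \<Rightarrow> nat list set set) \<Rightarrow> (nat \<Rightarrow> nat list set set)" where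
  "mult \<alpha> \<gamma> = (\<lambda>m. {S. S \<subseteq> H m \<and> {f \<in> H m. S \<in> act \<alpha> f} \<in> \<gamma> m})"

definition right_ideal :: "(nat \<Rightarrow> nat list set set) set \<Rightarrow> bool" where
  "right_ideal M \<longleftrightarrow> M \<noteq> {} \<and> M \<subseteq> SG \<and> (\<forall>\<alpha>\<in>M. \<forall>\<gamma>\<in>SG. mult \<alpha> \<gamma> \<in> M)"

definition minimal_subflow :: "(nat \<Rightarrow> nat list set set) set \<Rightarrow> bool" where
  "minimal_subflow M \<longleftrightarrow> right_ideal M \<and> (\<forall>K. right_ideal K \<and> K \<subseteq> M \<longrightarrow> K = M)"

definition idempotent :: "(nat \<Rightarrow> nat list set set) \<Rightarrow> bool" where
  "idempotent u \<longleftrightarrow> mult u u = u"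

definition F2 :: "(nat \<Rightarrow> nat list set set) set \<Rightarrow> nat list set set" where
  "F2 Y = {T. T \<subseteq> H 2 \<and> (\<forall>\<alpha>\<in>Y. T \<in> \<alpha> 2)}"

definition pairs :: "nat set set" where
  "pairs = {A. card A = 2}"

definition phi :: "nat list \<Rightarrow> nat set" where
  "phi x = set x"

definition phi_img :: "nat list set set \<Rightarrow> nat set set set" where
  "phi_img F = {T. T \<subseteq> pairs \<and> {x \<in> H 2. phi x \<in> T} \<in> F}"

definition LO :: "nat rel set" where
  "LO = {r. linear_order_on UNIV r}"

definition Aset :: "nat rel \<Rightarrow> nat rel \<Rightarrow> nat set set" where
  "Aset r0 r1 = {{a, b} | a b. a \<noteq> b \<and> ((a, b) \<in> r0 \<longleftrightarrow> (a, b) \<in> r1)}"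

definition AM :: "(nat \<Rightarrow> nat list set set) set \<Rightarrow> (nat rel \<times> nat rel) set" where
  "AM M = {(r0, r1). r0 \<in> LO \<and> r1 \<in> LO \<and> Aset r0 r1 \<in> phi_img (F2 M)}"

end

(* By Ramsey's theorem some p in S(G) is order invariant: p f depends only on the order type of f.
   Then so is q = alpha p for any alpha in M, and M = q S(G). An order invariant q sends every linear
   order r to the usual order of the natural numbers or to its reverse; call this sign the orientation
   of r. Hence r (q gamma) is, up to that sign, (<=) gamma, and q gamma is determined by (<=) gamma. It
   follows that (r0, r1) is in A^M iff r0 and r1 have the same orientation, that alpha in M is idempotent
   iff it preserves the orientation of some (equivalently, every) order r, and that {r alpha | alpha in M}
   is all of LO. So A^M is an equivalence relation with two classes, and idempotents of M move an order
   freely within its class. *)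

theory Submission
  imports Defs "HOL-Library.Ramsey"
begin

section \<open>Ultrafilters\<close>

lemma ultrafilter_onI:
  assumes "\<And>A. A \<in> U \<Longrightarrow> A \<subseteq> X" "X \<in> U" "{} \<notin> U"
    "\<And>A B. A \<in> U \<Longrightarrow> B \<in> U \<Longrightarrow> A \<inter> B \<in> U"
    "\<And>A B. A \<in> U \<Longrightarrow> A \<subseteq> B \<Longrightarrow> B \<subseteq> X \<Longrightarrow> B \<in> U"
    "\<And>A. A \<subseteq> X \<Longrightarrow> A \<in> U \<or> X - A \<in> U"
  shows "ultrafilter_on X U"
proof -
  have "U \<subseteq> Pow X" using assms(1) by blast
  moreover have "\<forall>A\<in>U. \<forall>B\<in>U. A \<inter> B \<in> U" using assms(4) by simp
  moreover have "\<forall>A\<in>U. \<forall>B. A \<subseteq> B \<and> B \<subseteq> X \<longrightarrow> B \<in> U" using assms(5) by simp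
  moreover have "\<forall>A. A \<subseteq> X \<longrightarrow> A \<in> U \<or> X - A \<in> U" using assms(6) by simp
  ultimately show ?thesis unfolding ultrafilter_on_def using assms(2,3) by (intro conjI)
qed

lemma ultrafilter_Int: "ultrafilter_on X U \<Longrightarrow> A \<in> U \<Longrightarrow> B \<in> U \<Longrightarrow> A \<inter> B \<in> U"
  by (simp add: ultrafilter_on_def)

lemma ultrafilter_mono: "ultrafilter_on X U \<Longrightarrow> A \<in> U \<Longrightarrow> A \<subseteq> B \<Longrightarrow> B \<subseteq> X \<Longrightarrow> B \<in> U"
  by (simp add: ultrafilter_on_def)

lemma ultrafilter_subset: "ultrafilter_on X U \<Longrightarrow> A \<in> U \<Longrightarrow> A \<subseteq> X"
  by (auto simp: ultrafilter_on_def)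

lemma ultrafilter_space: "ultrafilter_on X U \<Longrightarrow> X \<in> U"
  by (auto simp: ultrafilter_on_def)

lemma ultrafilter_empty: "ultrafilter_on X U \<Longrightarrow> {} \<notin> U"
  by (auto simp: ultrafilter_on_def)

lemma ultrafilter_Compl: 
  assumes "ultrafilter_on X U" "A \<subseteq> X" 
  shows "X - A \<in> U \<longleftrightarrow> A \<notin> U"
proof -
  have "A \<inter> (X - A) \<notin> U" using ultrafilter_empty[OF assms(1)] by simp
  moreover have "A \<in> U \<or> X - A \<in> U" using assms unfolding ultrafilter_on_def by simp
  ultimately show ?thesis using ultrafilter_Int[OF assms(1), of A "X - A"] by argo
qed

lemma ultrafilter_not:
  "ultrafilter_on X U \<Longrightarrow> {x \<in> X. \<not> P x} \<in> U \<longleftrightarrow> {x \<in> X. P x} \<notin> U"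
proof -
  assume "ultrafilter_on X U"
  moreover have "{x \<in> X. \<not> P x} = X - {x \<in> X. P x}" by blast
  ultimately show ?thesis by (simp add: ultrafilter_Compl)
qed

lemma ultrafilter_conj:
  assumes "ultrafilter_on X U"
  shows "{x \<in> X. P x \<and> Q x} \<in> U \<longleftrightarrow> {x \<in> X. P x} \<in> U \<and> {x \<in> X. Q x} \<in> U"
proof
  assume "{x \<in> X. P x \<and> Q x} \<in> U"
  then show "{x \<in> X. P x} \<in> U \<and> {x \<in> X. Q x} \<in> U"
    by (auto intro: ultrafilter_mono[OF assms])
next
  assume "{x \<in> X. P x} \<in> U \<and> {x \<in> X. Q x} \<in> U"
  then have "{x \<in> X. P x} \<inter> {x \<in> X. Q x} \<in> U"
    by (simp add: ultrafilter_Int[OF assms])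
  moreover have "{x \<in> X. P x} \<inter> {x \<in> X. Q x} = {x \<in> X. P x \<and> Q x}" by blast
  ultimately show "{x \<in> X. P x \<and> Q x} \<in> U" by simp
qed

lemma ultrafilter_iff:
  assumes U: "ultrafilter_on X U"
  shows "{x \<in> X. P x \<longleftrightarrow> Q x} \<in> U \<longleftrightarrow> ({x \<in> X. P x} \<in> U \<longleftrightarrow> {x \<in> X. Q x} \<in> U)"
proof -
  have "{x \<in> X. P x \<longleftrightarrow> Q x} = {x \<in> X. \<not> (P x \<and> \<not> Q x) \<and> \<not> (\<not> P x \<and> Q x)}" by blast
  then show ?thesis
    by (simp only: ultrafilter_not[OF U] ultrafilter_conj[OF U]) blast
qed

lemma ultrafilter_INT:
  assumes U: "ultrafilter_on X U" and "finite I" "\<And>i. i \<in> I \<Longrightarrow> {x \<in> X. P i x} \<in> U"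
  shows "{x \<in> X. \<forall>i\<in>I. P i x} \<in> U"
  using assms(2,3)
proof (induction I)
  case empty
  then show ?case using ultrafilter_space[OF U] by simp
next
  case (insert i I)
  then show ?case using ultrafilter_conj[OF U, of "P i" "\<lambda>x. \<forall>i\<in>I. P i x"] by simp
qed

lemma ultrafilter_nonempty: "ultrafilter_on X U \<Longrightarrow> {x \<in> X. P x} \<in> U \<Longrightarrow> \<exists>x\<in>X. P x"
proof (rule ccontr)
  assume "ultrafilter_on X U" "{x \<in> X. P x} \<in> U" "\<not> (\<exists>x\<in>X. P x)"
  then have "{} \<in> U"
    by (metis (no_types, lifting) Collect_empty_eq)
  then show False using \<open>ultrafilter_on X U\<close> ultrafilter_empty by blast
qed

lemma ultrafilter_principal: "x \<in> X \<Longrightarrow> ultrafilter_on X {S. S \<subseteq> X \<and> x \<in> S}"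
  by (auto simp: ultrafilter_on_def)

text \<open>This is the limit of the ultrafilters \<open>W y\<close> along \<open>V\<close>. Each
  \<open>mult \<alpha> \<gamma> m\<close> has this form, with \<open>act \<alpha>\<close> as
  \<open>W\<close>. The axioms hold pointwise for \<open>W y\<close> and are carried through
  \<open>V\<close>.\<close>

lemma ultrafilter_bind:
  assumes V: "ultrafilter_on Y V" and W: "\<And>y. y \<in> Y \<Longrightarrow> ultrafilter_on X (W y)"
  shows "ultrafilter_on X {S. S \<subseteq> X \<and> {y \<in> Y. S \<in> W y} \<in> V}" (is "ultrafilter_on X ?U")
proof -
  have "{y \<in> Y. X \<in> W y} = Y" 
    using W ultrafilter_space by blast
  then have 1: "X \<in> ?U" using ultrafilter_space[OF V] by simp
  have "{y \<in> Y. {} \<in> W y} = {}" 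
    using W ultrafilter_empty by blast
  then have 2: "{} \<notin> ?U" using ultrafilter_empty[OF V] by (simp only: mem_Collect_eq) simp
  have 3: "A \<inter> B \<in> ?U" if "A \<in> ?U" "B \<in> ?U" for A B
  proof -
    have "{y \<in> Y. A \<in> W y \<and> B \<in> W y} \<in> V"
      using that by (simp add: ultrafilter_conj[OF V])
    then have "{y \<in> Y. A \<inter> B \<in> W y} \<in> V"
      by (rule ultrafilter_mono[OF V]) (auto intro: ultrafilter_Int[OF W])
    then show ?thesis using that by blast
  qed
  have 4: "B \<in> ?U" if "A \<in> ?U" "A \<subseteq> B" "B \<subseteq> X" for A B
  proof -
    have "{y \<in> Y. B \<in> W y} \<in> V"
      using that by (auto intro: ultrafilter_mono[OF V] ultrafilter_mono[OF W])
    then show ?thesis using that by blast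
  qed
  have 5: "A \<in> ?U \<or> X - A \<in> ?U" if "A \<subseteq> X" for A
  proof -
    have "{y \<in> Y. X - A \<in> W y} = {y \<in> Y. \<not> A \<in> W y}"
      using ultrafilter_Compl[OF W \<open>A \<subseteq> X\<close>] by blast
    then show ?thesis
      using that ultrafilter_not[OF V, of "\<lambda>y. A \<in> W y"] by auto
  qed
  show ?thesis
    by (rule ultrafilter_onI[OF _ 1 2 3 4 5]) simp_all
qed

text \<open>The push-forward under \<open>h\<close> is the limit along \<open>V\<close> of the
  principal ultrafilters at the points \<open>h y\<close>.\<close>

lemma ultrafilter_image:
  assumes "ultrafilter_on Y V" "\<And>y. y \<in> Y \<Longrightarrow> h y \<in> X"
  shows "ultrafilter_on X {S. S \<subseteq> X \<and> {y \<in> Y. h y \<in> S} \<in> V}"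
proof -
  have "{S. S \<subseteq> X \<and> {y \<in> Y. h y \<in> S} \<in> V} = {S. S \<subseteq> X \<and> {y \<in> Y. S \<in> {S. S \<subseteq> X \<and> h y \<in> S}} \<in> V}"
    by auto
  moreover have "ultrafilter_on X {S. S \<subseteq> X \<and> {y \<in> Y. S \<in> {S. S \<subseteq> X \<and> h y \<in> S}} \<in> V}"
    by (rule ultrafilter_bind[OF assms(1) ultrafilter_principal[OF assms(2)]])
  ultimately show ?thesis by simp
qed

section \<open>Families with the finite intersection property\<close>

definition fip :: "'a set \<Rightarrow> 'a set set \<Rightarrow> bool" where
  "fip X C \<longleftrightarrow> C \<subseteq> Pow X \<and> (\<forall>F. finite F \<and> F \<subseteq> C \<longrightarrow> X \<inter> \<Inter>F \<noteq> {})"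

text \<open>Zorn's lemma gives a maximal family with \<open>fip X\<close> above \<open>B\<close>,
  and maximality makes it an ultrafilter. As \<open>\<Inter>{}\<close> is \<open>UNIV\<close>, the
  intersection with \<open>X\<close> in \<open>fip\<close> makes the empty subfamily say that
  \<open>X\<close> is nonempty.\<close>

lemma ultrafilter_extends_fip:
  assumes "fip X B"
  obtains U where "ultrafilter_on X U" "B \<subseteq> U"
proof -
  let ?A = "{C. fip X C \<and> B \<subseteq> C}"
  have "\<exists>U\<in>?A. \<forall>C\<in>?A. U \<subseteq> C \<longrightarrow> C = U"
  proof (rule subset_Zorn_nonempty)
    show "?A \<noteq> {}" using assms by blast
    fix c assume c: "c \<noteq> {}" "subset.chain ?A c"
    have c': "fip X C" "B \<subseteq> C" if "C \<in> c" for C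
      using c(2) that by (auto simp: subset.chain_def)
    have "X \<inter> \<Inter>F \<noteq> {}" if F: "finite F" "F \<subseteq> \<Union>c" for F
    proof -
      obtain C where "C \<in> c" "F \<subseteq> C"
        using finite_subset_Union_chain[OF F c] .
      then show ?thesis
        using c'(1)[of C] F(1) by (simp add: fip_def)
    qed
    moreover have "\<Union>c \<subseteq> Pow X" using c'(1) unfolding fip_def by blast
    moreover have "B \<subseteq> \<Union>c" using c(1) c'(2) by fast
    ultimately show "\<Union>c \<in> ?A" by (simp add: fip_def)
  qed
  then obtain U where UA: "U \<in> ?A" and maxA: "\<forall>C\<in>?A. U \<subseteq> C \<longrightarrow> C = U" ..
  have U: "fip X U" "B \<subseteq> U" using UA by auto
  have max: "C = U" if "fip X C" "U \<subseteq> C" for C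
    using maxA that U(2) by auto
  \<comment> \<open>A set meeting every finite intersection from \<open>U\<close> can be added to
    \<open>U\<close> without losing \<open>fip\<close>, so it is already a member. The facts
    \<open>1\<close>, \<open>3\<close>, \<open>4\<close> and \<open>5\<close> below rest on this
    criterion.\<close>
  have mem: "A \<in> U" if "A \<subseteq> X" and *: "\<And>F. finite F \<Longrightarrow> F \<subseteq> U \<Longrightarrow> A \<inter> \<Inter>F \<noteq> {}" for A
  proof -
    have "X \<inter> \<Inter>F \<noteq> {}" if "finite F" "F \<subseteq> insert A U" for F
    proof -
      have "A \<inter> \<Inter>(F - {A}) \<noteq> {}"
        using that by (intro *) auto
      moreover have "A \<inter> \<Inter>(F - {A}) \<subseteq> X \<inter> \<Inter>F" using \<open>A \<subseteq> X\<close> by blast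
      ultimately show ?thesis by blast
    qed
    then have "fip X (insert A U)"
      using U(1) that(1) by (simp add: fip_def)
    then have "insert A U = U" using max by blast
    then show ?thesis by blast
  qed
  have ne: "X \<inter> \<Inter>F \<noteq> {}" if "finite F" "F \<subseteq> U" for F
    using U(1) that by (simp add: fip_def)
  have sub: "A \<subseteq> X" if "A \<in> U" for A
    using U(1) that unfolding fip_def by blast
  have 1: "X \<in> U" by (rule mem) (use ne in auto)
  have 2: "{} \<notin> U" using ne[of "{{}}"] by auto
  have 3: "A \<inter> C \<in> U" if "A \<in> U" "C \<in> U" for A C
  proof (rule mem)
    fix F assume "finite F" "F \<subseteq> U"
    then have "X \<inter> \<Inter>(insert A (insert C F)) \<noteq> {}"
      using that by (intro ne) auto
    then show "A \<inter> C \<inter> \<Inter>F \<noteq> {}" by auto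
  qed (use that sub in blast)
  have 4: "C \<in> U" if "A \<in> U" "A \<subseteq> C" "C \<subseteq> X" for A C
  proof (rule mem)
    fix F assume "finite F" "F \<subseteq> U"
    then have "X \<inter> \<Inter>(insert A F) \<noteq> {}"
      using that by (intro ne) auto
    then show "C \<inter> \<Inter>F \<noteq> {}" using that by auto
  qed fact
  have 5: "A \<in> U \<or> X - A \<in> U" if A: "A \<subseteq> X" for A
  proof (rule ccontr)
    assume "\<not> (A \<in> U \<or> X - A \<in> U)"
    \<comment> \<open>If the criterion fails for \<open>A\<close> and for \<open>X - A\<close>,
      finite subfamilies \<open>F\<close> and \<open>G\<close> witness this, and together they have
      no common point in \<open>X\<close>.\<close>
    then obtain F G where "finite F" "F \<subseteq> U" "A \<inter> \<Inter>F = {}" "finite G" "G \<subseteq> U" "(X - A) \<inter> \<Inter>G = {}"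
      using mem[OF A] mem[of "X - A"] by blast
    moreover have "X \<inter> \<Inter>(F \<union> G) \<subseteq> (A \<inter> \<Inter>F) \<union> ((X - A) \<inter> \<Inter>G)" by blast
    ultimately show False using ne[of "F \<union> G"] by simp
  qed
  have "ultrafilter_on X U"
    by (rule ultrafilter_onI[OF sub 1 2 3 4 5])
  then show ?thesis using U(2) that by blast
qed

section \<open>The semigroup \<open>S(G)\<close>\<close>

lemma SG_ultrafilter: "\<alpha> \<in> SG \<Longrightarrow> ultrafilter_on (H n) (\<alpha> n)"
  by (simp add: SG_def)

lemma SG_coherent:
  "\<alpha> \<in> SG \<Longrightarrow> m \<le> n \<Longrightarrow> S \<in> \<alpha> m \<longleftrightarrow> S \<subseteq> H m \<and> {x \<in> H n. take m x \<in> S} \<in> \<alpha> n"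
  unfolding SG_def by blast

section \<open>The ultrafilters \<open>act \<alpha> f\<close> and the product\<close>

lemma set_less_bnd: "set f \<subseteq> {..<bnd f}"
  by (auto simp: bnd_def less_Suc_eq_le)

lemma take_H: "m \<le> n \<Longrightarrow> x \<in> H n \<Longrightarrow> take m x \<in> H m"
  by (simp add: H_def)

lemma take_conv_map_nth: "m \<le> length x \<Longrightarrow> take m x = map ((!) x) [0..<m]"
  by (rule nth_equalityI) auto

lemma map_nth_H: "x \<in> H n \<Longrightarrow> f \<in> H k \<Longrightarrow> set f \<subseteq> {..<n} \<Longrightarrow> map ((!) x) f \<in> H k"
  by (auto simp: H_def distinct_map inj_on_def nth_eq_iff_index_eq subset_iff)

lemma SG_coherent_map_nth:
  assumes \<alpha>: "\<alpha> \<in> SG" and "m \<le> n" "set f \<subseteq> {..<m}"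
  shows "{x \<in> H m. map ((!) x) f \<in> S} \<in> \<alpha> m \<longleftrightarrow> {x \<in> H n. map ((!) x) f \<in> S} \<in> \<alpha> n"
proof -
  have eq: "map ((!) (take m x)) f = map ((!) x) f" for x :: "nat list"
    using assms(3) by auto
  have "{x \<in> H n. take m x \<in> {x \<in> H m. map ((!) x) f \<in> S}} = {x \<in> H n. map ((!) x) f \<in> S}"
    by (auto simp: eq take_H[OF \<open>m \<le> n\<close>])
  then show ?thesis
    using SG_coherent[OF \<alpha> \<open>m \<le> n\<close>, of "{x \<in> H m. map ((!) x) f \<in> S}"] by auto
qed

text \<open>The level \<open>bnd f\<close> in \<open>act\<close> is only a choice: coherence of
  \<open>\<alpha>\<close> gives the same result at every level \<open>n\<close> above the entries of
  \<open>f\<close>. The two cases are the two directions in which levels can be compared.\<close>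

lemma act_iff:
  assumes \<alpha>: "\<alpha> \<in> SG" and f: "set f \<subseteq> {..<n}"
  shows "S \<in> act \<alpha> f \<longleftrightarrow> S \<subseteq> H (length f) \<and> {x \<in> H n. map ((!) x) f \<in> S} \<in> \<alpha> n"
proof (cases "n \<le> bnd f")
  case True
  then show ?thesis
    unfolding act_def using SG_coherent_map_nth[OF \<alpha> True f, of S] by simp
next
  case False
  then have "bnd f \<le> n" by simp
  then show ?thesis
    unfolding act_def using SG_coherent_map_nth[OF \<alpha> _ set_less_bnd] by simp
qed

lemma act_ultrafilter:
  assumes "\<alpha> \<in> SG" "f \<in> H m"
  shows "ultrafilter_on (H m) (act \<alpha> f)"
proof -
  have [simp]: "length f = m" using assms(2) by (simp add: H_def)
  show ?thesis
    unfolding act_def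
    using ultrafilter_image[OF SG_ultrafilter[OF assms(1)], of "bnd f" "\<lambda>x. map ((!) x) f" "H m"]
      map_nth_H[OF _ assms(2) set_less_bnd] by simp
qed

text \<open>Precomposition with \<open>f\<close> pushes \<alpha>.y forward to \<alpha>.(y o f),
  where y o f is \<open>map ((!) y) f\<close>. Both sides are measured at level
  \<open>bnd y\<close>, which also bounds the entries of y o f, and there they are the same
  set.\<close>

lemma act_map_nth:
  assumes \<alpha>: "\<alpha> \<in> SG" and y: "y \<in> H n" and f: "f \<in> H k" "set f \<subseteq> {..<n}" and S: "S \<subseteq> H k"
  shows "{x \<in> H n. map ((!) x) f \<in> S} \<in> act \<alpha> y \<longleftrightarrow> S \<in> act \<alpha> (map ((!) y) f)"
proof -
  let ?N = "bnd y"
  have len: "length y = n" "length f = k" using y f by (auto simp: H_def)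
  have "set (map ((!) y) f) \<subseteq> set y" using f(2) len by auto
  then have sub: "set (map ((!) y) f) \<subseteq> {..<?N}" using set_less_bnd[of y] by blast
  have eq: "map ((!) (map ((!) z) y)) f = map ((!) z) (map ((!) y) f)" for z :: "nat list"
    using f(2) len by auto
  have "{z \<in> H ?N. map ((!) z) y \<in> {x \<in> H n. map ((!) x) f \<in> S}}
      = {z \<in> H ?N. map ((!) z) (map ((!) y) f) \<in> S}"
    by (simp only: mem_Collect_eq eq) (use map_nth_H[OF _ y set_less_bnd] in blast)
  then show ?thesis
    using act_iff[OF \<alpha> set_less_bnd, of _ y] act_iff[OF \<alpha> sub, of S] S len by auto
qed

text \<open>The formula defining the product stays valid with \<open>act \<gamma> f\<close> in place
  of \<open>\<gamma> m\<close>: \<open>act_map_nth\<close> moves the pull-back along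
  \<open>f\<close> from the argument of \<open>act \<alpha>\<close> to the lists measured by
  \<open>\<gamma>\<close>. Associativity and the action on linear orders depend on this.\<close>

lemma act_mult:
  assumes \<alpha>: "\<alpha> \<in> SG" and \<gamma>: "\<gamma> \<in> SG" and f: "f \<in> H k" and S: "S \<subseteq> H k"
  shows "S \<in> act (mult \<alpha> \<gamma>) f \<longleftrightarrow> {g \<in> H k. S \<in> act \<alpha> g} \<in> act \<gamma> f"
proof -
  let ?n = "bnd f"
  have len: "length f = k" using f by (simp add: H_def)
  have "S \<in> act (mult \<alpha> \<gamma>) f \<longleftrightarrow> {x \<in> H ?n. map ((!) x) f \<in> S} \<in> mult \<alpha> \<gamma> ?n"
    using S len unfolding act_def[of "mult \<alpha> \<gamma>"] by simp
  also have "\<dots> \<longleftrightarrow> {y \<in> H ?n. {x \<in> H ?n. map ((!) x) f \<in> S} \<in> act \<alpha> y} \<in> \<gamma> ?n"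
    unfolding mult_def by simp
  also have "{y \<in> H ?n. {x \<in> H ?n. map ((!) x) f \<in> S} \<in> act \<alpha> y}
      = {y \<in> H ?n. map ((!) y) f \<in> {g \<in> H k. S \<in> act \<alpha> g}}"
    using act_map_nth[OF \<alpha> _ f set_less_bnd S] map_nth_H[OF _ f set_less_bnd] by blast
  also have "\<dots> \<in> \<gamma> ?n \<longleftrightarrow> {g \<in> H k. S \<in> act \<alpha> g} \<in> act \<gamma> f"
    using len unfolding act_def[of \<gamma>] by simp
  finally show ?thesis .
qed

text \<open>Restriction to \<open>m\<close> is precomposition with \<open>[0..<m]\<close>, so
  \<open>act_map_nth\<close> reduces coherence of the product to coherence of
  \<open>\<gamma>\<close>.\<close>

lemma mult_SG:
  assumes \<alpha>: "\<alpha> \<in> SG" and \<gamma>: "\<gamma> \<in> SG"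
  shows "mult \<alpha> \<gamma> \<in> SG"
proof -
  have "ultrafilter_on (H n) (mult \<alpha> \<gamma> n)" for n
    unfolding mult_def
    using ultrafilter_bind[OF SG_ultrafilter[OF \<gamma>]] act_ultrafilter[OF \<alpha>] by blast
  moreover have "S \<in> mult \<alpha> \<gamma> m \<longleftrightarrow> S \<subseteq> H m \<and> {x \<in> H n. take m x \<in> S} \<in> mult \<alpha> \<gamma> n"
    if "m \<le> n" for m n S
  proof (cases "S \<subseteq> H m")
    case True
    have up: "[0..<m] \<in> H m" "set [0..<m] \<subseteq> {..<n}" using that by (auto simp: H_def)
    have take: "take m x = map ((!) x) [0..<m]" if "x \<in> H n" for x
      using that \<open>m \<le> n\<close> take_conv_map_nth[of m x] by (simp add: H_def)
    have "S \<in> act \<alpha> (take m y) \<longleftrightarrow> {x \<in> H n. take m x \<in> S} \<in> act \<alpha> y" if "y \<in> H n" for y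
      using act_map_nth[OF \<alpha> that up True] take[OF that] by (simp add: take cong: conj_cong)
    then have "{y \<in> H n. take m y \<in> {f \<in> H m. S \<in> act \<alpha> f}}
        = {y \<in> H n. {x \<in> H n. take m x \<in> S} \<in> act \<alpha> y}"
      using take_H[OF \<open>m \<le> n\<close>] by auto
    then show ?thesis
      using SG_coherent[OF \<gamma> that, of "{f \<in> H m. S \<in> act \<alpha> f}"] True by (auto simp: mult_def)
  qed (simp add: mult_def)
  ultimately show ?thesis by (auto simp: SG_def)
qed

lemma mult_assoc:
  assumes \<alpha>: "\<alpha> \<in> SG" and \<gamma>: "\<gamma> \<in> SG"
  shows "mult (mult \<alpha> \<gamma>) \<delta> = mult \<alpha> (mult \<gamma> \<delta>)"
proof
  fix m
  have "{f \<in> H m. S \<in> act (mult \<alpha> \<gamma>) f} = {f \<in> H m. {g \<in> H m. S \<in> act \<alpha> g} \<in> act \<gamma> f}"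
    if "S \<subseteq> H m" for S
    using act_mult[OF \<alpha> \<gamma> _ that] by blast
  then show "mult (mult \<alpha> \<gamma>) \<delta> m = mult \<alpha> (mult \<gamma> \<delta>) m"
    by (auto simp: mult_def)
qed

section \<open>Elements of S(G) as limits of injections\<close>

abbreviation injs :: "(nat \<Rightarrow> nat) set" where
  "injs \<equiv> {g. inj g}"

text \<open>The limit along \<open>U\<close> of the injections of omega into itself: coordinate
  \<open>m\<close> is the push-forward of \<open>U\<close> under restriction to \<open>m\<close>.
  Surjectivity is not asked for, because only finite restrictions are seen and the maps built below,
  such as enumerations of infinite sets, need not be onto.\<close>

definition inj_limit :: "(nat \<Rightarrow> nat) set set \<Rightarrow> nat \<Rightarrow> nat list set set" where
  "inj_limit U = (\<lambda>m. {S. S \<subseteq> H m \<and> {g \<in> injs. map g [0..<m] \<in> S} \<in> U})"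

lemma map_inj_H: "inj g \<Longrightarrow> f \<in> H k \<Longrightarrow> map g f \<in> H k"
  by (auto simp: H_def distinct_map inj_on_def)

lemma upt_H: "[0..<m] \<in> H m"
  by (simp add: H_def)

lemma inj_limit_SG:
  assumes U: "ultrafilter_on injs U"
  shows "inj_limit U \<in> SG"
proof -
  have "ultrafilter_on (H n) (inj_limit U n)" for n
    unfolding inj_limit_def
    by (rule ultrafilter_image[OF U]) (simp add: map_inj_H upt_H)
  moreover have "S \<in> inj_limit U m \<longleftrightarrow> S \<subseteq> H m \<and> {x \<in> H n. take m x \<in> S} \<in> inj_limit U n"
    if "m \<le> n" for m n S
  proof -
    have "{g \<in> injs. map g [0..<n] \<in> {x \<in> H n. take m x \<in> S}} = {g \<in> injs. map g [0..<m] \<in> S}"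
      using that by (auto simp: map_inj_H upt_H take_map)
    then show ?thesis by (auto simp: inj_limit_def)
  qed
  ultimately show ?thesis by (auto simp: SG_def)
qed

lemma act_inj_limit:
  assumes "f \<in> H k"
  shows "S \<in> act (inj_limit U) f \<longleftrightarrow> S \<subseteq> H k \<and> {g \<in> injs. map g f \<in> S} \<in> U"
proof -
  have len: "length f = k" using assms by (simp add: H_def)
  have eq: "map ((!) (map g [0..<bnd f])) f = map g f" for g :: "nat \<Rightarrow> nat"
    using set_less_bnd[of f] by auto
  have "{g \<in> injs. map g [0..<bnd f] \<in> {x \<in> H (bnd f). map ((!) x) f \<in> S}} = {g \<in> injs. map g f \<in> S}"
    by (auto simp: eq map_inj_H upt_H simp del: map_map)
  then show ?thesis by (auto simp: act_def inj_limit_def len)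
qed

section \<open>Order invariance and Ramsey's theorem\<close>

definition order_type :: "nat list \<Rightarrow> nat rel" where
  "order_type f = {(i, j). i < length f \<and> j < length f \<and> f ! i < f ! j}"

text \<open>The order type tells how many entries lie below the entry at position \<open>i\<close>,
  and within a fixed set of numbers this rank determines the entry.\<close>

lemma order_type_inj:
  assumes f: "f \<in> H m" and g: "g \<in> H m" and s: "set f = set g" and ot: "order_type f = order_type g"
  shows "f = g"
proof (rule nth_equalityI)
  have len: "length f = m" "length g = m" and d: "distinct f" "distinct g"
    using f g by (auto simp: H_def)
  show "length f = length g" using len by simp
  fix i assume i: "i < length f"
  have rank: "card {b \<in> set h. b < h ! i} = card {j. (j, i) \<in> order_type h}"
    if "distinct h" "length h = m" for h
  proof -
    have "{b \<in> set h. b < h ! i} = (!) h ` {j. (j, i) \<in> order_type h}"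
      using i len that by (auto simp: order_type_def in_set_conv_nth)
    moreover have "inj_on ((!) h) {j. (j, i) \<in> order_type h}"
      using that by (auto simp: inj_on_def order_type_def nth_eq_iff_index_eq)
    ultimately show ?thesis by (simp add: card_image)
  qed
  have eq: "card {b \<in> set f. b < f ! i} = card {b \<in> set f. b < g ! i}"
    using rank[OF d(1) len(1)] rank[OF d(2) len(2)] ot s by simp
  have mono: "card {b \<in> set f. b < x} < card {b \<in> set f. b < y}" if "x < y" "x \<in> set f" for x y
    using that by (intro psubset_card_mono) auto
  have "f ! i \<in> set f" "g ! i \<in> set f" using i len s nth_mem[of i f] nth_mem[of i g] by simp_all
  then show "f ! i = g ! i"
    using mono[of "f ! i" "g ! i"] mono[of "g ! i" "f ! i"] eq
    by (cases "f ! i" "g ! i" rule: linorder_cases) simp_all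
qed

lemma order_type_map_strict_mono: "strict_mono g \<Longrightarrow> order_type (map g f) = order_type f"
  by (auto simp: order_type_def strict_mono_less)

text \<open>The lengths are compared separately because lists of length 0 and 1 both have the empty
  order type.\<close>

definition homogeneous :: "nat list set \<Rightarrow> nat set \<Rightarrow> bool" where
  "homogeneous S Y \<longleftrightarrow> (\<forall>f g. distinct f \<and> distinct g \<and> set f \<subseteq> Y \<and> set g \<subseteq> Y \<and> order_type f = order_type g
     \<and> length f = length g \<longrightarrow> (f \<in> S \<longleftrightarrow> g \<in> S))"

text \<open>Colour an \<open>m\<close>-element set by the order types of the lists in
  \<open>S\<close> that enumerate it. By \<open>order_type_inj\<close> this colour and the order
  type of a list decide whether the list is in \<open>S\<close>, so a set on which the colour is
  constant is homogeneous.\<close>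

lemma ex_homogeneous:
  assumes S: "S \<subseteq> H m" and Z: "infinite Z"
  obtains Y where "Y \<subseteq> Z" "infinite Y" "homogeneous S Y"
proof -
  define c where "c X = order_type ` {f \<in> S. set f = X}" for X
  define D where "D = Pow (Pow ({..<m} \<times> {..<m}))"
  have "finite D" by (simp add: D_def)
  \<comment> \<open>\<open>Ramsey\<close> expects colours that are naturals below a bound;
    \<open>e\<close> numbers the finitely many possible colours.\<close>
  then obtain e :: "nat rel set \<Rightarrow> nat" and s where e: "e ` D = {..<s}" "inj_on e D"
    using finite_imp_inj_to_nat_seg by (metis lessThan_def)
  have cD: "c X \<in> D" for X
    using S by (fastforce simp: c_def D_def order_type_def H_def)
  have "\<forall>X. X \<subseteq> Z \<and> finite X \<and> card X = m \<longrightarrow> e (c X) < s"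
    using cD e(1) by blast
  from Ramsey[OF Z this] obtain Y t where Y: "Y \<subseteq> Z" "infinite Y"
    and t: "\<forall>X. X \<subseteq> Y \<and> finite X \<and> card X = m \<longrightarrow> e (c X) = t"
    by (elim exE conjE) (rule that)
  have c_iff: "f \<in> S \<longleftrightarrow> order_type f \<in> c (set f)" if "f \<in> H m" for f
    using order_type_inj[OF that] S by (auto simp: c_def)
  have "homogeneous S Y"
    unfolding homogeneous_def
  proof (intro allI impI, elim conjE)
    fix f g
    assume *: "distinct f" "distinct g" "set f \<subseteq> Y" "set g \<subseteq> Y" "order_type f = order_type g" 
      "length f = length g"
    show "f \<in> S \<longleftrightarrow> g \<in> S"
    proof (cases "length f = m")
      case True
      then have "e (c (set f)) = e (c (set g))"
        using * t by (simp add: distinct_card)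
      then have "c (set f) = c (set g)"
        using e(2) cD by (simp add: inj_on_eq_iff)
      then show ?thesis
        using c_iff[of f] c_iff[of g] * True by (simp add: H_def)
    next
      case False
      then show ?thesis using S * by (auto simp: H_def)
    qed
  qed
  then show ?thesis using Y that by blast
qed

lemma homogeneous_subset: "homogeneous S Y \<Longrightarrow> Z \<subseteq> Y \<Longrightarrow> homogeneous S Z"
  unfolding homogeneous_def by (meson subset_trans)

text \<open>Ramsey's theorem is applied once for each set, inside the infinite set found before;
  homogeneity passes to subsets.\<close>

lemma ex_homogeneous_finite:
  assumes "finite F" "\<And>S. S \<in> F \<Longrightarrow> \<exists>m. S \<subseteq> H m"
  shows "\<exists>Y. infinite Y \<and> (\<forall>S\<in>F. homogeneous S Y)"
  using assms
proof (induction F)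
  case empty
  then show ?case using infinite_UNIV_nat by blast
next
  case (insert S F)
  then obtain Z where Z: "infinite Z" "\<forall>S\<in>F. homogeneous S Z" by auto
  obtain m where "S \<subseteq> H m" using insert.prems by blast
  then obtain Y where Y: "Y \<subseteq> Z" "infinite Y" "homogeneous S Y"
    using ex_homogeneous[OF _ Z(1)] by metis
  have "homogeneous T Y" if "T \<in> F" for T
    using Z(2) that homogeneous_subset[OF _ Y(1)] by simp
  then show ?case using Y(2,3) by (intro exI[of _ Y]) simp
qed

definition order_invariant :: "(nat \<Rightarrow> nat list set set) \<Rightarrow> bool" where
  "order_invariant q \<longleftrightarrow> (\<forall>m f g. f \<in> H m \<and> g \<in> H m \<and> order_type f = order_type g \<longrightarrow> act q f = act q g)"

text \<open>A compactness argument: \<open>B S\<close> holds the increasing maps whose range is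
  homogeneous for \<open>S\<close>. Finitely many of these sets have a common element, so some
  ultrafilter \<open>U\<close> contains them all, and its limit is order invariant.\<close>

lemma ex_order_invariant:
  obtains p where "p \<in> SG" "order_invariant p"
proof -
  define B where "B S = {h :: nat \<Rightarrow> nat. strict_mono h \<and> homogeneous S (range h)}" for S
  have "fip injs (B ` {S. \<exists>m. S \<subseteq> H m})"
    unfolding fip_def
  proof (intro conjI allI impI; (elim conjE)?)
    show "B ` {S. \<exists>m. S \<subseteq> H m} \<subseteq> Pow injs"
      by (auto simp: B_def strict_mono_imp_inj_on)
    fix F assume F: "finite F" "F \<subseteq> B ` {S. \<exists>m. S \<subseteq> H m}"
    obtain F' where F': "F' \<subseteq> {S. \<exists>m. S \<subseteq> H m}" "finite F'" "F = B ` F'"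
      using finite_subset_image[OF F] by (elim exE conjE) (rule that)
    obtain Y where Y: "infinite Y" "\<forall>S\<in>F'. homogeneous S Y"
      using ex_homogeneous_finite[OF F'(2)] F'(1) by auto
    \<comment> \<open>The increasing enumeration of a set homogeneous for all of \<open>F'\<close>
      lies in every member of \<open>F\<close>.\<close>
    let ?g = "enumerate Y"
    have "strict_mono ?g" using Y(1) strict_mono_enumerate by blast
    then have "inj ?g" "strict_mono ?g" by (auto intro: strict_mono_imp_inj_on)
    moreover have "range ?g = Y" using range_enumerate[OF Y(1)] .
    ultimately have "?g \<in> injs \<inter> \<Inter>F" using Y(2) F'(3) by (simp add: B_def)
    then show "injs \<inter> \<Inter>F \<noteq> {}" by blast
  qed
  then obtain U where U: "ultrafilter_on injs U" "B ` {S. \<exists>m. S \<subseteq> H m} \<subseteq> U"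
    using ultrafilter_extends_fip by blast
  have imp: "{h \<in> injs. map h g \<in> S} \<in> U"
    if fg: "f \<in> H m" "g \<in> H m" "order_type f = order_type g" and "S \<subseteq> H m" 
      and S: "{h \<in> injs. map h f \<in> S} \<in> U" for f g m S
  proof -
    have "B S \<in> U" using U(2) \<open>S \<subseteq> H m\<close> by blast
    then have "B S \<inter> {h \<in> injs. map h f \<in> S} \<in> U"
      using S ultrafilter_Int[OF U(1)] by blast
    then show ?thesis
    proof (rule ultrafilter_mono[OF U(1)])
      show "B S \<inter> {h \<in> injs. map h f \<in> S} \<subseteq> {h \<in> injs. map h g \<in> S}"
      proof
        fix h assume "h \<in> B S \<inter> {h \<in> injs. map h f \<in> S}"
        then have h: "strict_mono h" "inj h" "homogeneous S (range h)" "map h f \<in> S"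
          by (auto simp: B_def)
        have "map h f \<in> H m" "map h g \<in> H m"
          using map_inj_H[OF h(2)] fg by auto
        moreover have "order_type (map h f) = order_type (map h g)"
          \<comment> \<open>Increasing maps preserve order types, so homogeneity of the range of
            \<open>h\<close> applies to the two image lists.\<close>
          using fg(3) order_type_map_strict_mono[OF h(1)] by simp
        ultimately have "map h f \<in> S \<longleftrightarrow> map h g \<in> S"
          using h(3)[unfolded homogeneous_def, rule_format, of "map h f" "map h g"]
          by (auto simp: H_def)
        then have "map h g \<in> S" using h(4) by simp
        then show "h \<in> {h \<in> injs. map h g \<in> S}" using h(2) by blast
      qed
    qed blast
  qed
  have "order_invariant (inj_limit U)"
    unfolding order_invariant_def
  proof (intro allI impI set_eqI, elim conjE)
    fix m f g S
    assume fg: "f \<in> H m" "g \<in> H m" "order_type f = order_type g"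
    show "S \<in> act (inj_limit U) f \<longleftrightarrow> S \<in> act (inj_limit U) g"
      unfolding act_inj_limit[OF fg(1)] act_inj_limit[OF fg(2)]
      using imp[OF fg, of S] imp[OF fg(2,1) fg(3)[symmetric], of S] by argo
  qed
  then show ?thesis by (rule that[OF inj_limit_SG[OF U(1)]])
qed

section \<open>The action on linear orders\<close>

lemma LO_iff:
  "r \<in> LO \<longleftrightarrow> (\<forall>a. (a, a) \<in> r) \<and> (\<forall>a b c. (a, b) \<in> r \<longrightarrow> (b, c) \<in> r \<longrightarrow> (a, c) \<in> r)
    \<and> (\<forall>a b. (a, b) \<in> r \<longrightarrow> (b, a) \<in> r \<longrightarrow> a = b) \<and> (\<forall>a b. (a, b) \<in> r \<or> (b, a) \<in> r)"
proof -
  have "r \<in> LO \<longleftrightarrow> refl r \<and> trans r \<and> antisym r \<and> total r"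
    by (auto simp: LO_def linear_order_on_def partial_order_on_def preorder_on_def)
  moreover have "(\<forall>a b. (a, b) \<in> r \<or> (b, a) \<in> r) \<longleftrightarrow> refl r \<and> total r"
    by (auto simp: total_on_def refl_on_def) metis
  ultimately show ?thesis
    unfolding trans_def antisym_def by (auto simp only: refl_on_def UNIV_I)
qed

lemma LO_converse_mem: "r \<in> LO \<Longrightarrow> a \<noteq> b \<Longrightarrow> (b, a) \<in> r \<longleftrightarrow> (a, b) \<notin> r"
  unfolding LO_iff by blast

lemma LO_converse: "r \<in> LO \<Longrightarrow> r\<inverse> \<in> LO"
  unfolding LO_iff by blast

text \<open>A pair of \<open>s\<close> missing from \<open>r\<close> would have its converse in
  \<open>r\<close>, hence in \<open>s\<close>, against antisymmetry. Equality of linear orders thus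
  needs only one inclusion.\<close>

lemma LO_subset_eq: "r \<in> LO \<Longrightarrow> s \<in> LO \<Longrightarrow> r \<subseteq> s \<Longrightarrow> r = s"
  unfolding LO_iff by fast

definition leq :: "nat rel" where
  "leq = {(a, b). a \<le> b}"

lemma leq_LO: "leq \<in> LO"
  by (auto simp: LO_iff leq_def)

definition increasing :: "nat rel \<Rightarrow> nat list set" where
  "increasing r = {x \<in> H 2. (x ! 0, x ! 1) \<in> r}"

text \<open>The right action on LO(omega): \<open>a\<close> is below \<open>b\<close> when
  \<alpha>-almost every injection sends \<open>a\<close> below \<open>b\<close> in \<open>r\<close>.
  The diagonal is added by hand because \<open>[a, a]\<close> is not in \<open>H 2\<close>.\<close>

definition LO_act :: "nat rel \<Rightarrow> (nat \<Rightarrow> nat list set set) \<Rightarrow> nat rel" where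
  "LO_act r \<alpha> = {(a, b). a = b \<or> increasing r \<in> act \<alpha> [a, b]}"

lemma H2_iff: "x \<in> H 2 \<longleftrightarrow> (\<exists>a b. x = [a, b] \<and> a \<noteq> b)"
  by (auto simp: H_def numeral_2_eq_2 length_Suc_conv)

lemma increasing_subset: "increasing r \<subseteq> H 2"
  by (auto simp: increasing_def)

lemma LO_act_iff:
  assumes \<alpha>: "\<alpha> \<in> SG" and r: "r \<in> LO" and "a < n" "b < n"
  shows "(a, b) \<in> LO_act r \<alpha> \<longleftrightarrow> {x \<in> H n. (x ! a, x ! b) \<in> r} \<in> \<alpha> n"
proof (cases "a = b")
  case True
  then have "{x \<in> H n. (x ! a, x ! b) \<in> r} = H n" using r by (auto simp: LO_iff)
  then show ?thesis
    using True ultrafilter_space[OF SG_ultrafilter[OF \<alpha>]] by (simp add: LO_act_def)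
next
  case False
  then have "[a, b] \<in> H 2" by (simp add: H2_iff)
  then have "map ((!) x) [a, b] \<in> H 2" if "x \<in> H n" for x
    using map_nth_H[OF that, of "[a, b]" 2] assms(3,4) by simp
  then have "{x \<in> H n. map ((!) x) [a, b] \<in> increasing r} = {x \<in> H n. (x ! a, x ! b) \<in> r}"
    by (auto simp: increasing_def)
  then show ?thesis
    using False act_iff[OF \<alpha>, of "[a, b]" n "increasing r"] increasing_subset[of r] assms(3,4)
    by (simp add: LO_act_def numeral_2_eq_2)
qed

text \<open>Each axiom concerns at most three points. At a level \<open>n\<close> above them it
  holds for every \<open>x\<close> in \<open>H n\<close>, and the ultrafilter
  \<open>\<alpha> n\<close> passes it on; antisymmetry also uses that \<open>x\<close> is
  injective.\<close>

lemma LO_act_LO: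
  assumes \<alpha>: "\<alpha> \<in> SG" and r: "r \<in> LO"
  shows "LO_act r \<alpha> \<in> LO"
  unfolding LO_iff
proof (intro conjI allI impI)
  note r' = r[unfolded LO_iff]
  fix a b c :: nat
  define n where "n = Suc (a + b + c)"
  have less: "a < n" "b < n" "c < n" by (auto simp: n_def)
  note mem = LO_act_iff[OF \<alpha> r]
  note U = SG_ultrafilter[OF \<alpha>, of n]
  show "(a, a) \<in> LO_act r \<alpha>" by (simp add: LO_act_def)
  show "(a, c) \<in> LO_act r \<alpha>" if "(a, b) \<in> LO_act r \<alpha>" "(b, c) \<in> LO_act r \<alpha>"
  proof -
    have "{x \<in> H n. (x ! a, x ! b) \<in> r \<and> (x ! b, x ! c) \<in> r} \<in> \<alpha> n"
      using that less by (simp add: mem[of _ n] ultrafilter_conj[OF U])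
    then have "{x \<in> H n. (x ! a, x ! c) \<in> r} \<in> \<alpha> n"
      by (rule ultrafilter_mono[OF U]) (use r' in blast)+
    then show ?thesis using less by (simp add: mem[of _ n])
  qed
  show "a = b" if "(a, b) \<in> LO_act r \<alpha>" "(b, a) \<in> LO_act r \<alpha>"
  proof -
    have "{x \<in> H n. (x ! a, x ! b) \<in> r \<and> (x ! b, x ! a) \<in> r} \<in> \<alpha> n"
      using that less by (simp add: mem[of _ n] ultrafilter_conj[OF U])
    then have "\<exists>x\<in>H n. (x ! a, x ! b) \<in> r \<and> (x ! b, x ! a) \<in> r"
      by (rule ultrafilter_nonempty[OF U])
    then obtain x where "x \<in> H n" "x ! a = x ! b" using r' by blast
    then show ?thesis using less by (simp add: H_def nth_eq_iff_index_eq)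
  qed
  show "(a, b) \<in> LO_act r \<alpha> \<or> (b, a) \<in> LO_act r \<alpha>"
  proof (rule ccontr)
    assume "\<not> ?thesis"
    then have "{x \<in> H n. \<not> (x ! a, x ! b) \<in> r \<and> \<not> (x ! b, x ! a) \<in> r} \<in> \<alpha> n"
      using less by (simp add: mem[of _ n] ultrafilter_conj[OF U] ultrafilter_not[OF U])
    then have "\<exists>x\<in>H n. \<not> (x ! a, x ! b) \<in> r \<and> \<not> (x ! b, x ! a) \<in> r"
      by (rule ultrafilter_nonempty[OF U])
    then show False using r' by blast
  qed
qed

text \<open>\<open>increasing (LO_act r \<alpha>)\<close> is exactly the set of pairs that
  \<open>act_mult\<close> hands to \<open>\<beta>\<close>, so this is a right action.\<close>

lemma LO_act_mult:
  assumes \<alpha>: "\<alpha> \<in> SG" and \<beta>: "\<beta> \<in> SG"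
  shows "LO_act r (mult \<alpha> \<beta>) = LO_act (LO_act r \<alpha>) \<beta>"
proof -
  have "increasing (LO_act r \<alpha>) = {f \<in> H 2. increasing r \<in> act \<alpha> f}"
    unfolding increasing_def[of "LO_act r \<alpha>"] by (auto simp: LO_act_def H2_iff)
  then have "increasing r \<in> act (mult \<alpha> \<beta>) [a, b] \<longleftrightarrow> increasing (LO_act r \<alpha>) \<in> act \<beta> [a, b]"
    if "a \<noteq> b" for a b
    using act_mult[OF \<alpha> \<beta> _ increasing_subset, of "[a, b]"] that by (simp add: H2_iff)
  then show ?thesis by (auto simp: LO_act_def[of _ "mult \<alpha> \<beta>"] LO_act_def[of _ \<beta>])
qed

lemma LO_act_converse:
  assumes \<alpha>: "\<alpha> \<in> SG" and r: "r \<in> LO"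
  shows "LO_act (r\<inverse>) \<alpha> = (LO_act r \<alpha>)\<inverse>"
proof -
  have "(a, b) \<in> LO_act (r\<inverse>) \<alpha> \<longleftrightarrow> (a, b) \<in> (LO_act r \<alpha>)\<inverse>" for a b
    using LO_act_iff[OF \<alpha> r, of b "Suc (a + b)" a] 
      LO_act_iff[OF \<alpha> LO_converse[OF r], of a "Suc (a + b)" b]
    by simp
  then show ?thesis by (simp only: set_eq_iff split_paired_All) simp
qed

section \<open>Reversing orders by a sign\<close>

definition signed :: "bool \<Rightarrow> 'a rel \<Rightarrow> 'a rel" where
  "signed s r = (if s then r else r\<inverse>)"

lemma LO_act_signed: "\<alpha> \<in> SG \<Longrightarrow> r \<in> LO \<Longrightarrow> LO_act (signed s r) \<alpha> = signed s (LO_act r \<alpha>)"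
  by (simp add: signed_def LO_act_converse)

lemma signed_inject: "signed s r = signed s r' \<longleftrightarrow> r = r'"
  by (simp add: signed_def)

lemma signed_LO: "r \<in> LO \<Longrightarrow> signed s r \<in> LO"
  by (simp add: signed_def LO_converse)

lemma signed_signed: "signed s (signed s r) = r"
  by (simp add: signed_def)

text \<open>Exactly one of \<open>r\<close> and its converse contains a given off-diagonal pair, so
  a single comparison reveals the sign.\<close>

lemma signed_mem_eq_iff:
  "r \<in> LO \<Longrightarrow> a \<noteq> b \<Longrightarrow> ((a, b) \<in> signed s r \<longleftrightarrow> (a, b) \<in> signed t r) \<longleftrightarrow> s = t"
  using LO_converse_mem[of r a b] by (auto simp: signed_def)

lemma signed_eq_iff: "r \<in> LO \<Longrightarrow> signed s r = signed t r \<longleftrightarrow> s = t"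
  using signed_mem_eq_iff[of r 0 1 s t] by auto

lemma LO_initial_segment_embedding:
  assumes r: "r \<in> LO"
  shows "\<exists>g :: nat \<Rightarrow> nat. inj g \<and> (\<forall>i<n. \<forall>j<n. g i \<le> g j \<longleftrightarrow> (i, j) \<in> r)"
proof -
  define D where "D i = {j. j < n \<and> (j, i) \<in> r}" for i
  \<comment> \<open>Below \<open>n\<close> the value is the rank of \<open>i\<close> in
    \<open>r\<close> among the numbers below \<open>n\<close>, counting \<open>i\<close> itself.
    These ranks are at most \<open>n\<close>, so \<open>Suc i\<close> for \<open>i \<ge> n\<close>
    avoids them.\<close>
  define g where "g i = (if i < n then card (D i) else Suc i)" for i
  note r' = r[unfolded LO_iff]
  have fin: "finite (D i)" for i by (simp add: D_def)
  have le: "card (D i) \<le> card (D j)" if "(i, j) \<in> r" for i j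
    using that r' fin by (intro card_mono) (auto simp: D_def)
  have less: "card (D i) < card (D j)" if "(i, j) \<in> r" "i \<noteq> j" "j < n" for i j
  proof (intro psubset_card_mono fin psubsetI)
    show "D i \<subseteq> D j" using that r' by (auto simp: D_def)
    have "j \<in> D j" "j \<notin> D i" using that r' by (auto simp: D_def)
    then show "D i \<noteq> D j" by blast
  qed
  have iff: "g i \<le> g j \<longleftrightarrow> (i, j) \<in> r" if "i < n" "j < n" for i j
  proof
    assume "g i \<le> g j"
    then show "(i, j) \<in> r"
      using less[of j i] that r' by (fastforce simp: g_def)
  qed (use le that in \<open>simp add: g_def\<close>)
  have small: "g i \<le> n" if "i < n" for i
    using that card_mono[of "{..<n}" "D i"] by (auto simp: g_def D_def)
  have "i = j" if "g i = g j" for i j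
  proof (cases "i < n"; cases "j < n")
    assume "i < n" "j < n"
    then have "(i, j) \<in> r" "(j, i) \<in> r" using iff that by (metis order_refl)+
    then show ?thesis using r' by blast
  qed (use that small[of i] small[of j] in \<open>auto simp: g_def split: if_splits\<close>)
  then have "inj g" by (rule injI)
  then show ?thesis using iff by blast
qed

text \<open>Compactness again: \<open>B n\<close> holds the injections turning \<open>r\<close> into
  the usual order on the numbers below \<open>n\<close>. Any ultrafilter containing all
  \<open>B n\<close> has a limit that carries \<open>leq\<close> to \<open>r\<close>.\<close>

lemma LO_act_leq_surj:
  assumes r: "r \<in> LO"
  obtains \<gamma> where "\<gamma> \<in> SG" "LO_act leq \<gamma> = r"
proof -
  define B where "B n = {g \<in> injs. \<forall>i<n. \<forall>j<n. g i \<le> g j \<longleftrightarrow> (i, j) \<in> r}" for n :: nat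
  have "fip injs (range B)"
    unfolding fip_def
  proof (intro conjI allI impI; (elim conjE)?)
    show "range B \<subseteq> Pow injs" by (auto simp: B_def)
    fix F assume F: "finite F" "F \<subseteq> range B"
    obtain I where I: "finite I" "F = B ` I"
      using finite_subset_image[OF F] by (elim exE conjE) (rule that)
    \<comment> \<open>The sets \<open>B n\<close> decrease with \<open>n\<close>, so the largest
      index serves for all of \<open>I\<close>. For empty \<open>I\<close> the value of
      \<open>Max I\<close> is immaterial, as only injectivity of \<open>g\<close> matters.\<close>
    obtain g :: "nat \<Rightarrow> nat" where g: "inj g" "\<forall>i<Max I. \<forall>j<Max I. g i \<le> g j \<longleftrightarrow> (i, j) \<in> r"
      using LO_initial_segment_embedding[OF r] by blast
    have "g \<in> B n" if "n \<in> I" for n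
    proof -
      have "n \<le> Max I" using I(1) that by simp
      then show ?thesis using g by (simp add: B_def)
    qed
    then have "g \<in> injs \<inter> \<Inter>F" using g(1) I(2) by blast
    then show "injs \<inter> \<Inter>F \<noteq> {}" by blast
  qed
  then obtain U where U: "ultrafilter_on injs U" "range B \<subseteq> U"
    using ultrafilter_extends_fip by blast
  have \<gamma>: "inj_limit U \<in> SG" using inj_limit_SG[OF U(1)] .
  have "r \<subseteq> LO_act leq (inj_limit U)"
  proof (rule subrelI)
    fix a b assume ab: "(a, b) \<in> r"
    show "(a, b) \<in> LO_act leq (inj_limit U)"
    proof (cases "a = b")
      case False
      then have H2: "[a, b] \<in> H 2" by (simp add: H2_iff)
      have "B (Suc (a + b)) \<in> U" using U(2) by blast
      then have "{g \<in> injs. map g [a, b] \<in> increasing leq} \<in> U"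
      proof (rule ultrafilter_mono[OF U(1)])
        show "B (Suc (a + b)) \<subseteq> {g \<in> injs. map g [a, b] \<in> increasing leq}"
        proof
          fix g assume g: "g \<in> B (Suc (a + b))"
          then have "g a \<le> g b" "inj g" using ab by (auto simp: B_def)
          then show "g \<in> {g \<in> injs. map g [a, b] \<in> increasing leq}"
            using map_inj_H[OF _ H2, of g] by (simp add: increasing_def leq_def)
        qed
      qed blast
      then show ?thesis
        using act_inj_limit[OF H2] increasing_subset by (simp add: LO_act_def)
    qed (simp add: LO_act_def)
  qed
  then have "LO_act leq (inj_limit U) = r"
    using LO_subset_eq[OF r LO_act_LO[OF \<gamma> leq_LO]] by simp
  then show ?thesis using \<gamma> that by blast
qed

section \<open>Minimal subflows\<close>

text \<open>\<open>D\<close> consists of the lists ordered like \<open>LO_act leq \<gamma>\<close>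
  on the positions below \<open>m\<close>. It belongs to \<open>\<gamma> m\<close> and to
  \<open>\<gamma>' m\<close>, and \<open>act q\<close> is constant on it, so both products contain
  the same sets.\<close>

lemma order_invariant_mult_cong:
  assumes q: "order_invariant q" and \<gamma>: "\<gamma> \<in> SG" "\<gamma>' \<in> SG" 
    and eq: "LO_act leq \<gamma> = LO_act leq \<gamma>'"
  shows "mult q \<gamma> = mult q \<gamma>'"
proof
  fix m :: nat
  define I where "I = {..<m} \<times> {..<m}"
  define D where "D = {f \<in> H m. \<forall>p\<in>I. f ! fst p \<le> f ! snd p \<longleftrightarrow> p \<in> LO_act leq \<gamma>}"
  have D: "D \<in> \<delta> m" if \<delta>: "\<delta> \<in> SG" "LO_act leq \<delta> = LO_act leq \<gamma>" for \<delta>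
    unfolding D_def
  proof (rule ultrafilter_INT)
    show U: "ultrafilter_on (H m) (\<delta> m)" using SG_ultrafilter[OF \<delta>(1)] .
    show "finite I" by (simp add: I_def)
    fix p assume "p \<in> I"
    then obtain i j where p: "p = (i, j)" "i < m" "j < m" by (auto simp: I_def)
    \<comment> \<open>A condition independent of \<open>x\<close> defines all of \<open>H m\<close>
      or nothing; this handles the fixed side of the equivalence in \<open>D\<close>.\<close>
    have const: "{x \<in> H m. c} \<in> \<delta> m \<longleftrightarrow> c" for c
      using ultrafilter_space[OF U] ultrafilter_empty[OF U] by (cases c) simp_all
    show "{x \<in> H m. x ! fst p \<le> x ! snd p \<longleftrightarrow> p \<in> LO_act leq \<gamma>} \<in> \<delta> m"
      using LO_act_iff[OF \<delta>(1) leq_LO p(2,3)] \<delta>(2)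
      by (simp add: ultrafilter_iff[OF U] const p(1) leq_def)
  qed
  have ot: "order_type f = order_type g" if "f \<in> D" "g \<in> D" for f g
  proof -
    have "f ! j \<le> f ! i \<longleftrightarrow> g ! j \<le> g ! i" if "i < m" "j < m" for i j
      using \<open>f \<in> D\<close> \<open>g \<in> D\<close> that by (simp add: D_def I_def)
    then have "f ! i < f ! j \<longleftrightarrow> g ! i < g ! j" if "i < m" "j < m" for i j
      using that linorder_not_le by metis
    then show ?thesis
      using that by (auto simp: D_def order_type_def H_def)
  qed
  have imp: "{f \<in> H m. S \<in> act q f} \<in> \<delta>' m"
    if S: "{f \<in> H m. S \<in> act q f} \<in> \<delta> m" 
      and \<delta>: "\<delta> \<in> SG" "LO_act leq \<delta> = LO_act leq \<gamma>" "\<delta>' \<in> SG" "LO_act leq \<delta>' = LO_act leq \<gamma>" for S \<delta> \<delta>'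
  proof -
    note U = SG_ultrafilter[OF \<delta>(1), of m] SG_ultrafilter[OF \<delta>(3), of m]
    have "{f \<in> H m. S \<in> act q f} \<inter> D \<in> \<delta> m"
      using ultrafilter_Int[OF U(1) S D[OF \<delta>(1,2)]] .
    then have "{f \<in> H m. S \<in> act q f} \<inter> D \<noteq> {}"
      using ultrafilter_empty[OF U(1)] by metis
    then obtain f where f: "f \<in> H m" "S \<in> act q f" "f \<in> D" by blast
    show ?thesis
    proof (rule ultrafilter_mono[OF U(2) D[OF \<delta>(3,4)]])
      show "D \<subseteq> {f \<in> H m. S \<in> act q f}"
      proof
        fix g assume g: "g \<in> D"
        then have "g \<in> H m" by (simp add: D_def)
        then have "act q g = act q f"
          using q f(1) ot[OF g f(3)] unfolding order_invariant_def by blast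
        then show "g \<in> {f \<in> H m. S \<in> act q f}" using f(2) \<open>g \<in> H m\<close> by simp
      qed
    qed blast
  qed
  show "mult q \<gamma> m = mult q \<gamma>' m"
    unfolding mult_def
    using imp[OF _ \<gamma>(1) refl \<gamma>(2) eq[symmetric]] imp[OF _ \<gamma>(2) eq[symmetric] \<gamma>(1) refl] by blast
qed

text \<open>By \<open>act_mult\<close>, \<open>act q f\<close> is computed from
  \<open>act p f\<close>, so \<open>q\<close> = \<alpha>p inherits invariance from \<open>p\<close>.
  As \<open>q\<close> is in \<open>M\<close>, the right ideal \<open>mult q\<close> applied to all
  of \<open>SG\<close> lies in \<open>M\<close> and equals it by minimality.\<close>

lemma minimal_subflow_generator:
  assumes "minimal_subflow M"
  obtains q where "q \<in> SG" "order_invariant q" "M = mult q ` SG"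
proof -
  have M: "right_ideal M" "\<And>K. right_ideal K \<Longrightarrow> K \<subseteq> M \<Longrightarrow> K = M"
    using assms by (auto simp: minimal_subflow_def)
  then obtain \<alpha> where \<alpha>: "\<alpha> \<in> M" "\<alpha> \<in> SG" by (auto simp: right_ideal_def)
  obtain p where p: "p \<in> SG" "order_invariant p" using ex_order_invariant .
  define q where "q = mult \<alpha> p"
  have q: "q \<in> SG" "q \<in> M"
    using M(1) \<alpha> p(1) mult_SG by (auto simp: q_def right_ideal_def)
  have "act q f = act q g" if fg: "f \<in> H m" "g \<in> H m" "order_type f = order_type g" for f g m
  proof -
    have "act p f = act p g" using p(2) fg unfolding order_invariant_def by blast
    then have "S \<in> act q f \<longleftrightarrow> S \<in> act q g" if "S \<subseteq> H m" for S
      using act_mult[OF \<alpha>(2) p(1) _ that] fg by (simp add: q_def)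
    then show ?thesis
      using ultrafilter_subset[OF act_ultrafilter[OF q(1) fg(1)]] 
        ultrafilter_subset[OF act_ultrafilter[OF q(1) fg(2)]] by blast
  qed
  then have inv: "order_invariant q" unfolding order_invariant_def by blast
  have "right_ideal (mult q ` SG)"
    unfolding right_ideal_def using q(1) mult_SG by (auto simp: mult_assoc)
  moreover have "mult q ` SG \<subseteq> M"
    using q(2) M(1) by (auto simp: right_ideal_def)
  ultimately show ?thesis using M(2) q(1) inv that by blast
qed

text \<open>The pair 0, 1 is a sample: for order invariant \<open>q\<close> every pair
  \<open>a < b\<close> gives the same answer.\<close>

definition orientation :: "(nat \<Rightarrow> nat list set set) \<Rightarrow> nat rel \<Rightarrow> bool" where
  "orientation q r \<longleftrightarrow> (0, 1) \<in> LO_act r q"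

lemma orientation_converse:
  "q \<in> SG \<Longrightarrow> r \<in> LO \<Longrightarrow> orientation q (r\<inverse>) \<longleftrightarrow> \<not> orientation q r"
  using LO_converse_mem[OF LO_act_LO, of q r 0 1] by (simp add: orientation_def LO_act_converse)

text \<open>All lists \<open>[a, b]\<close> with \<open>a < b\<close> have one order type, so
  \<open>LO_act r q\<close> treats them alike.\<close>

lemma LO_act_order_invariant:
  assumes q: "q \<in> SG" "order_invariant q" and r: "r \<in> LO"
  shows "LO_act r q = signed (orientation q r) leq"
proof -
  have less: "(a, b) \<in> LO_act r q \<longleftrightarrow> orientation q r" if "a < b" for a b
  proof -
    have "order_type [a, b] = order_type [0, 1]"
      using that by (auto simp: order_type_def less_Suc_eq nth_Cons')
    moreover have "[a, b] \<in> H 2" "[0, 1] \<in> H 2" using that by (auto simp: H2_iff)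
    ultimately have "act q [a, b] = act q [0, 1]"
      using q(2) unfolding order_invariant_def by blast
    then show ?thesis using that by (simp add: orientation_def LO_act_def)
  qed
  note R = LO_act_LO[OF q(1) r]
  have "(a, b) \<in> LO_act r q \<longleftrightarrow> (a, b) \<in> signed (orientation q r) leq" for a b
    using less[of a b] less[of b a] LO_converse_mem[OF R, of a b] R[unfolded LO_iff]
    by (cases a b rule: linorder_cases) (auto simp: signed_def leq_def)
  then show ?thesis by auto
qed

lemma LO_act_mult_order_invariant:
  assumes "q \<in> SG" "order_invariant q" "r \<in> LO" "\<gamma> \<in> SG"
  shows "LO_act r (mult q \<gamma>) = signed (orientation q r) (LO_act leq \<gamma>)"
  by (simp add: LO_act_mult LO_act_order_invariant LO_act_signed leq_LO assms)

lemma Aset_mem_iff: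
  assumes \<alpha>: "\<alpha> \<in> SG" and r: "r0 \<in> LO" "r1 \<in> LO"
  shows "{x \<in> H 2. phi x \<in> Aset r0 r1} \<in> \<alpha> 2 \<longleftrightarrow> ((0, 1) \<in> LO_act r0 \<alpha> \<longleftrightarrow> (0, 1) \<in> LO_act r1 \<alpha>)"
proof -
  \<comment> \<open>Swapping \<open>a\<close> and \<open>b\<close> negates both comparisons, so
    agreement of the two orders depends only on the unordered pair.\<close>
  have "phi [a, b] \<in> Aset r0 r1 \<longleftrightarrow> ((a, b) \<in> r0 \<longleftrightarrow> (a, b) \<in> r1)" if "a \<noteq> b" for a b
    using that LO_converse_mem[OF r(1) that] LO_converse_mem[OF r(2) that]
    by (auto simp: phi_def Aset_def doubleton_eq_iff)
  then have "{x \<in> H 2. phi x \<in> Aset r0 r1} = {x \<in> H 2. (x ! 0, x ! 1) \<in> r0 \<longleftrightarrow> (x ! 0, x ! 1) \<in> r1}"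
    by (auto simp: H2_iff)
  then show ?thesis
    using LO_act_iff[OF \<alpha> r(1), of 0 2 1] LO_act_iff[OF \<alpha> r(2), of 0 2 1]
    by (simp add: ultrafilter_iff[OF SG_ultrafilter[OF \<alpha>]])
qed

text \<open>This packages what \<open>minimal_subflow_generator\<close> yields, to be interpreted
  once for each of the two subflows.\<close>

locale subflow =
  fixes M q
  assumes q: "q \<in> SG" "order_invariant q" and M: "M = mult q ` SG"
begin

lemma subset: "M \<subseteq> SG"
  using q(1) mult_SG by (auto simp: M)

lemma mult_closed: "\<alpha> \<in> M \<Longrightarrow> \<gamma> \<in> SG \<Longrightarrow> mult \<alpha> \<gamma> \<in> M"
  using q(1) mult_SG by (auto simp: M mult_assoc)

text \<open>Writing \<alpha> = q\<gamma>, the order \<open>D\<close> is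
  \<open>LO_act leq \<gamma>\<close>; it is the same for every \<open>r\<close>, and only the sign
  varies.\<close>

lemma act_eq:
  assumes "\<alpha> \<in> M"
  obtains D where "D \<in> LO" "\<And>r. r \<in> LO \<Longrightarrow> LO_act r \<alpha> = signed (orientation q r) D"
proof -
  obtain \<gamma> where "\<gamma> \<in> SG" "\<alpha> = mult q \<gamma>" using assms by (auto simp: M)
  then show ?thesis
    using that[of "LO_act leq \<gamma>"] LO_act_mult_order_invariant[OF q] LO_act_LO leq_LO by simp
qed

lemma AM_iff: "(r0, r1) \<in> AM M \<longleftrightarrow> r0 \<in> LO \<and> r1 \<in> LO \<and> orientation q r0 = orientation q r1"
proof (cases "r0 \<in> LO \<and> r1 \<in> LO")
  case True
  have "Aset r0 r1 \<subseteq> pairs" by (auto simp: Aset_def pairs_def)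
  then have "(r0, r1) \<in> AM M \<longleftrightarrow> (\<forall>\<alpha>\<in>M. {x \<in> H 2. phi x \<in> Aset r0 r1} \<in> \<alpha> 2)"
    using True by (auto simp: AM_def phi_img_def F2_def)
  also have "\<dots> \<longleftrightarrow> (\<forall>\<alpha>\<in>M. orientation q r0 = orientation q r1)"
  proof (rule ball_cong[OF refl])
    fix \<alpha> assume \<alpha>: "\<alpha> \<in> M"
    then obtain D where "D \<in> LO" "\<And>r. r \<in> LO \<Longrightarrow> LO_act r \<alpha> = signed (orientation q r) D"
      using act_eq by blast
    then show "{x \<in> H 2. phi x \<in> Aset r0 r1} \<in> \<alpha> 2 \<longleftrightarrow> orientation q r0 = orientation q r1"
      using True \<alpha> subset Aset_mem_iff[of \<alpha> r0 r1] signed_mem_eq_iff[of D 0 1] by auto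
  qed
  finally show ?thesis using True q(1) by (auto simp: M)
qed (auto simp: AM_def)

text \<open>The image of one order, with the sign cancelled, recovers
  \<open>LO_act leq \<gamma>\<close>, and \<open>order_invariant_mult_cong\<close> then recovers the
  element.\<close>

lemma eq_iff:
  assumes "\<alpha> \<in> M" "\<beta> \<in> M" "r \<in> LO"
  shows "\<alpha> = \<beta> \<longleftrightarrow> LO_act r \<alpha> = LO_act r \<beta>"
proof -
  obtain \<gamma> \<delta> where *: "\<gamma> \<in> SG" "\<alpha> = mult q \<gamma>" "\<delta> \<in> SG" "\<beta> = mult q \<delta>"
    using assms(1,2) by (auto simp: M)
  have "\<alpha> = \<beta>" if "LO_act r \<alpha> = LO_act r \<beta>"
  proof -
    have "LO_act leq \<gamma> = LO_act leq \<delta>"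
      using that by (simp add: * LO_act_mult_order_invariant[OF q assms(3)] signed_inject)
    then show ?thesis using order_invariant_mult_cong[OF q(2) *(1,3)] *(2,4) by simp
  qed
  then show ?thesis by blast
qed

text \<open>By \<open>eq_iff\<close> idempotence can be tested on the single order \<open>r\<close>.
  Acting by \<alpha> on \<open>LO_act r \<alpha>\<close> and on \<open>r\<close> gives the same
  \<open>D\<close> with the signs of these two orders, and the results agree iff the signs
  do.\<close>

lemma idempotent_iff:
  assumes \<alpha>: "\<alpha> \<in> M" and r: "r \<in> LO"
  shows "idempotent \<alpha> \<longleftrightarrow> orientation q (LO_act r \<alpha>) = orientation q r"
proof -
  have \<alpha>': "\<alpha> \<in> SG" using \<alpha> subset by blast
  obtain D where D: "D \<in> LO" "\<And>r. r \<in> LO \<Longrightarrow> LO_act r \<alpha> = signed (orientation q r) D"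
    using act_eq[OF \<alpha>] by blast
  have "idempotent \<alpha> \<longleftrightarrow> LO_act (LO_act r \<alpha>) \<alpha> = LO_act r \<alpha>"
    unfolding idempotent_def eq_iff[OF mult_closed[OF \<alpha> \<alpha>'] \<alpha> r] LO_act_mult[OF \<alpha>' \<alpha>'] ..
  also have "\<dots> \<longleftrightarrow> orientation q (LO_act r \<alpha>) = orientation q r"
    using D(2)[OF r] D(2)[OF LO_act_LO[OF \<alpha>' r]] signed_eq_iff[OF D(1)] by metis
  finally show ?thesis .
qed

lemma transitive:
  assumes "r \<in> LO" "r' \<in> LO"
  obtains \<alpha> where "\<alpha> \<in> M" "LO_act r \<alpha> = r'"
proof -
  \<comment> \<open>The target carries the sign of \<open>r\<close> so that it cancels the sign
    introduced by \<open>q\<close>.\<close>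
  obtain \<gamma> where \<gamma>: "\<gamma> \<in> SG" "LO_act leq \<gamma> = signed (orientation q r) r'"
    using LO_act_leq_surj[OF signed_LO[OF assms(2)]] by blast
  then have "LO_act r (mult q \<gamma>) = r'"
    using LO_act_mult_order_invariant[OF q assms(1)] by (simp add: signed_signed)
  then show ?thesis using \<gamma>(1) that by (auto simp: M)
qed

end

section \<open>Comparing the orientations of two minimal subflows\<close>

theorem mainTheorem10:
  assumes "minimal_subflow M" and "minimal_subflow N"
  shows "AM M = AM N \<longleftrightarrow>
    (\<forall>u\<in>M. \<forall>v\<in>N. idempotent u \<and> idempotent v \<longrightarrow> idempotent (mult u v))"
proof -
  obtain p where "subflow M p"
    using minimal_subflow_generator[OF assms(1)] subflow.intro by metis
  then interpret M: subflow M p .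
  obtain q where "subflow N q"
    using minimal_subflow_generator[OF assms(2)] subflow.intro by metis
  then interpret N: subflow N q .
  let ?s = "orientation p" and ?t = "orientation q"
  have act_LO: "LO_act r \<alpha> \<in> LO" if "r \<in> LO" "\<alpha> \<in> M \<union> N" for r \<alpha>
    using that LO_act_LO M.subset N.subset by blast
  \<comment> \<open>The product is in \<open>M\<close> because \<open>M\<close> is a right ideal, so
    the orientation for \<open>M\<close> tests its idempotence.\<close>
  have idem: "idempotent (mult u v) \<longleftrightarrow> ?s (LO_act (LO_act r u) v) = ?s r"
    if "u \<in> M" "v \<in> N" "r \<in> LO" for u v r
    using that M.idempotent_iff[OF M.mult_closed] LO_act_mult M.subset N.subset
    by (metis subsetD)
  show ?thesis
  proof (intro iffI ballI impI; (elim conjE)?)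
    fix u v assume eq: "AM M = AM N" and uv: "u \<in> M" "v \<in> N" "idempotent u" "idempotent v"
    let ?r = "LO_act leq u"
    have r: "?r \<in> LO" "LO_act ?r v \<in> LO" using act_LO leq_LO uv by auto
    \<comment> \<open>The idempotent \<open>v\<close> preserves the orientation for
      \<open>N\<close>; equality of the two relations turns this into preservation of the
      orientation for \<open>M\<close>.\<close>
    have "(LO_act ?r v, ?r) \<in> AM N"
      using N.idempotent_iff[OF uv(2) r(1)] uv(4) r by (simp add: N.AM_iff)
    then have "?s (LO_act ?r v) = ?s ?r" using eq M.AM_iff by blast
    also have "\<dots> = ?s leq" using M.idempotent_iff[OF uv(1) leq_LO] uv(3) by blast
    finally show "idempotent (mult u v)" using idem[OF uv(1,2) leq_LO] by simp
  next
    assume *: "\<forall>u\<in>M. \<forall>v\<in>N. idempotent u \<and> idempotent v \<longrightarrow> idempotent (mult u v)"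
    have imp: "?s b = ?s a" if ab: "a \<in> LO" "b \<in> LO" "?t b = ?t a" for a b
    proof -
      \<comment> \<open>\<open>u\<close> fixes \<open>a\<close> and \<open>v\<close> moves
        \<open>a\<close> to \<open>b\<close> within its class for \<open>N\<close>. Both are
        idempotent, so uv is too, and it sends \<open>a\<close> to \<open>b\<close>.\<close>
      obtain u where u: "u \<in> M" "LO_act a u = a" using M.transitive[OF ab(1,1)] .
      obtain v where v: "v \<in> N" "LO_act a v = b" using N.transitive[OF ab(1,2)] .
      have "idempotent u" using M.idempotent_iff[OF u(1) ab(1)] u(2) by simp
      moreover have "idempotent v" using N.idempotent_iff[OF v(1) ab(1)] v(2) ab(3) by simp
      ultimately have "idempotent (mult u v)" using * u(1) v(1) by blast
      then show ?thesis using idem[OF u(1) v(1) ab(1)] u(2) v(2) by simp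
    qed
    \<comment> \<open>For the other direction, if \<open>?t\<close> separates \<open>a\<close> and
      \<open>b\<close> then it agrees on the converse of \<open>a\<close> and \<open>b\<close>; by
      \<open>imp\<close> so does \<open>?s\<close>, which therefore separates \<open>a\<close> and
      \<open>b\<close>.\<close>
    have "?s a = ?s b \<longleftrightarrow> ?t a = ?t b" if "a \<in> LO" "b \<in> LO" for a b
      using imp[OF that] imp[OF LO_converse[OF that(1)] that(2)]
        orientation_converse[OF M.q(1) that(1)] orientation_converse[OF N.q(1) that(1)] by auto
    then have "(a, b) \<in> AM M \<longleftrightarrow> (a, b) \<in> AM N" for a b
      unfolding M.AM_iff N.AM_iff by metis
    then show "AM M = AM N" by (simp only: set_eq_iff split_paired_All) simp
  qed
qed

end
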